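(* Let $q$ be an odd prime power, $m_1,n_1,m_2,n_2\in\{1,\dots,q-1\}$, and suppose $D(q;m_1,n_1)\cong D(q;m_2,n_2)$. Then (i) $\gcd(m_1,q-1)=\gcd(m_2,q-1)$ and $\gcd(n_1,q-1)=\gcd(n_2,q-1)$; (ii) $\gcd(m_1+n_1,q-1)=\gcd(m_2+n_2,q-1)$; (iii) $\gcd(m_1-n_1,q-1)=\gcd(m_2-n_2,q-1)$. Moreover, these three conditions are independent: for each one of (i), (ii), (iii) there exist an odd prime power $q$ and parameters $m_1,n_1,m_2,n_2\in\{1,\dots,q-1\}$ satisfying the other two conditions but not that one.
   Context: $\mathbb{F}_q$ is the field with $q$ elements. For integers $1\le m,n\le q-1$, the monomial digraph $D(q;m,n)$ has vertex set $\mathbb{F}_q^2$, and $((x_1,x_2),(y_1,y_2))$ is an arc iff $x_2+y_2=x_1^m y_1^n$ (loops allowed). $\cong$ denotes digraph isomorphism. $\gcd(a,q-1)$ for an integer $a$ (possibly zero or negative) is the nonnegative greatest common divisor; in particular $\gcd(0,q-1)=q-1$. *)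

theory Defs
  imports
    "HOL-Library.Cardinality"
    "HOL-Number_Theory.Prime_Powers"
    "Graph_Theory.Pair_Digraph"
    "Graph_Theory.Digraph_Isomorphism"
begin

text \<open>
  The digraph \<open>D(q; m, n)\<close>, where \<open>\<FF>\<^sub>q\<close> is a finite field type \<open>'a\<close> with \<open>CARD('a) = q\<close>.
\<close>

definition monomial_digraph ::
    "nat \<Rightarrow> nat \<Rightarrow> ('a::{field,finite} \<times> 'a, ('a \<times> 'a) \<times> ('a \<times> 'a)) pre_digraph"
  where "monomial_digraph m n = with_proj
    \<lparr> pverts = UNIV,
      parcs = {((x1, x2), (y1, y2)) | x1 x2 y1 y2. x2 + y2 = x1 ^ m * y1 ^ n} \<rparr>"

definition gcd_exponents_eq :: "nat \<Rightarrow> nat \<Rightarrow> nat \<Rightarrow> nat \<Rightarrow> nat \<Rightarrow> bool"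
  where "gcd_exponents_eq q m1 n1 m2 n2 \<longleftrightarrow>
    gcd (int m1) (int q - 1) = gcd (int m2) (int q - 1) \<and>
    gcd (int n1) (int q - 1) = gcd (int n2) (int q - 1)"

definition gcd_sum_eq :: "nat \<Rightarrow> nat \<Rightarrow> nat \<Rightarrow> nat \<Rightarrow> nat \<Rightarrow> bool"
  where "gcd_sum_eq q m1 n1 m2 n2 \<longleftrightarrow>
    gcd (int m1 + int n1) (int q - 1) = gcd (int m2 + int n2) (int q - 1)"

definition gcd_diff_eq :: "nat \<Rightarrow> nat \<Rightarrow> nat \<Rightarrow> nat \<Rightarrow> nat \<Rightarrow> bool"
  where "gcd_diff_eq q m1 n1 m2 n2 \<longleftrightarrow>
    gcd (int m1 - int n1) (int q - 1) = gcd (int m2 - int n2) (int q - 1)"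

text \<open>
  The library's isomorphism maps vertices and arcs separately; as arcs are pairs here, it amounts
  to a bijection of the vertices that preserves and reflects adjacency.
\<close>

lemma digraph_iso_monomial_digraph_iff:
  "digraph_iso (monomial_digraph m1 n1 :: ('a::{field,finite} \<times> 'a, _) pre_digraph)
      (monomial_digraph m2 n2 :: ('a \<times> 'a, _) pre_digraph) \<longleftrightarrow>
    (\<exists>f :: 'a \<times> 'a \<Rightarrow> 'a \<times> 'a. bij f \<and>
      (\<forall>x y. snd x + snd y = fst x ^ m1 * fst y ^ n1 \<longleftrightarrow>
        snd (f x) + snd (f y) = fst (f x) ^ m2 * fst (f y) ^ n2))"
    (is "digraph_iso ?G ?H \<longleftrightarrow> (\<exists>f. bij f \<and> ?pres f)")
proof -
  have arcs_iff: "(x, y) \<in> arcs (monomial_digraph m n) \<longleftrightarrow> snd x + snd y = fst x ^ m * fst y ^ n"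
    for x y :: "'a \<times> 'a" and m n
    by (cases x; cases y) (simp add: monomial_digraph_def)
  have [simp]: "verts (monomial_digraph m n :: ('a \<times> 'a, _) pre_digraph) = UNIV"
    "tail (monomial_digraph m n :: ('a \<times> 'a, _) pre_digraph) = fst"
    "head (monomial_digraph m n :: ('a \<times> 'a, _) pre_digraph) = snd" for m n
    by (simp_all add: monomial_digraph_def)
  show ?thesis
  proof
    assume "digraph_iso ?G ?H"
    then obtain h where h: "pre_digraph.digraph_isomorphism ?G h" and H: "?H = app_iso h ?G"
      unfolding digraph_iso_def by blast
    let ?f = "iso_verts h"
    have th: "iso_tail h = fst" "iso_head h = snd"
      using arg_cong[OF H, of tail] arg_cong[OF H, of head] by simp_all
    have "surj ?f" using arg_cong[OF H, of verts] by simp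
    moreover have inj: "inj ?f"
      using h by (simp add: pre_digraph.digraph_isomorphism_def)
    moreover have ends: "iso_arcs h a = (?f (fst a), ?f (snd a))" if "a \<in> arcs ?G" for a
      using h that th by (simp add: pre_digraph.digraph_isomorphism_def prod_eq_iff)
    have "(x, y) \<in> arcs ?G \<longleftrightarrow> (?f x, ?f y) \<in> arcs ?H" for x y
    proof
      assume "(x, y) \<in> arcs ?G"
      then show "(?f x, ?f y) \<in> arcs ?H"
        using arg_cong[OF H, of arcs] ends[of "(x, y)"] by force
    next
      assume "(?f x, ?f y) \<in> arcs ?H"
      then obtain a where "a \<in> arcs ?G" "(?f x, ?f y) = iso_arcs h a"
        using arg_cong[OF H, of arcs] by auto
      then show "(x, y) \<in> arcs ?G"
        using ends[of a] inj by (cases a) (auto dest: injD)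
    qed
    ultimately show "\<exists>f. bij f \<and> ?pres f"
      unfolding arcs_iff bij_def by blast
  next
    assume "\<exists>f. bij f \<and> ?pres f"
    then obtain f where f: "bij f" "?pres f" by blast
    define h where "h = \<lparr>iso_verts = f, iso_arcs = map_prod f f, iso_head = snd, iso_tail = fst\<rparr>"
    have "wf_digraph ?G" by unfold_locales simp_all
    moreover have "inj (map_prod f f)"
      using f(1) by (simp add: bij_is_inj prod.inj_map)
    ultimately have "pre_digraph.digraph_isomorphism ?G h"
      using f(1) by (auto simp: pre_digraph.digraph_isomorphism_def h_def bij_is_inj
          intro: inj_on_subset)
    moreover have "arcs ?H = map_prod f f ` arcs ?G"
    proof (intro set_eqI iffI)
      fix b assume b: "b \<in> arcs ?H"
      obtain u v where uv: "b = (f u, f v)"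
        using f(1) by (metis bij_pointE surj_pair)
      then have "(u, v) \<in> arcs ?G" using b f(2) arcs_iff by blast
      then show "b \<in> map_prod f f ` arcs ?G" using uv by force
    next
      fix b assume "b \<in> map_prod f f ` arcs ?G"
      then obtain u v where "(u, v) \<in> arcs ?G" "b = (f u, f v)" by auto
      then show "b \<in> arcs ?H" using f(2) arcs_iff by blast
    qed
    then have "?H = app_iso h ?G"
      using f(1) by (intro pre_digraph.equality) (simp_all add: h_def bij_is_surj)
    ultimately show "digraph_iso ?G ?H" unfolding digraph_iso_def by blast
  qed
qed

end

theory Submission
  imports Defs "HOL-Computational_Algebra.Polynomial"
begin

text \<open>
  Each gcd is read off from the cardinality of a set of vertex pairs defined by adjacency alone.
  Write \<open>N\<^sub>k\<close> for the number of \<open>k\<close>-th roots of unity, which is \<open>gcd(k, q - 1)\<close>.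
  Two vertices have the same out-neighbours iff their second coordinates and the \<open>m\<close>-th powers of
  their first coordinates agree, so such pairs yield \<open>N\<^sub>m\<close>; in-neighbours yield \<open>N\<^sub>n\<close>. Pairs joined
  in both directions yield \<open>N\<^bsub>m-n\<^esub>\<close>. For \<open>m + n\<close>, suppose \<open>m \<noteq> n\<close>: the vertices whose in- and
  out-neighbourhoods coincide are exactly the \<open>(0, c)\<close>, and such a vertex points to all vertices with
  second coordinate \<open>-c\<close>. The looped vertices are the \<open>(a, a\<^bsup>m+n\<^esup>/2)\<close>, so two of them are pointed to by
  a common \<open>(0, c)\<close> iff their first coordinates have the same \<open>(m+n)\<close>-th power. If \<open>m = n\<close>, then
  \<open>gcd(2m, q - 1)\<close> is determined by \<open>gcd(m, q - 1)\<close>.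
\<close>

text \<open>Acting by \<open>f\<close> on both components carries one set onto the other; every
  count taken below passes through an isomorphism this way.\<close>

lemma card_pairs_eq_if_bij:
  assumes "bij f" and "\<And>x y. P x y \<longleftrightarrow> Q (f x) (f y)"
  shows "card {(x, y). P x y} = card {(x, y). Q x y}"
proof (rule bij_betw_same_card)
  show "bij_betw (map_prod f f) {(x, y). P x y} {(x, y). Q x y}"
    using assms unfolding bij_betw_def
    by (auto simp: inj_on_def bij_def image_iff) (metis surj_def)
qed

section \<open>Roots of unity and power equations over a finite field\<close>

lemma card_nonzero: "card (- {0 :: 'a::{zero,finite}}) = CARD('a) - 1"
  by (simp add: Compl_eq_Diff_UNIV card_Diff_singleton)

lemma card_field_gt_one: "CARD('a::{field,finite}) > 1"
  using card_mono[of UNIV "{0, 1 :: 'a}"] by simp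

text \<open>Multiplication by \<open>z\<close> permutes the nonzero elements, so their product
  absorbs one factor \<open>z\<close> for each of them.\<close>

lemma power_card_minus_one:
  fixes z :: "'a::{field,finite}"
  assumes "z \<noteq> 0"
  shows "z ^ (CARD('a) - 1) = 1"
proof -
  have "bij_betw ((*) z) (-{0}) (-{0})"
    using assms by (intro bij_betwI[where g = "\<lambda>x. x / z"]) auto
  then have "(\<Prod>x\<in>-{0}. z * x) = (\<Prod>x\<in>-{0::'a}. x)"
    by (rule prod.reindex_bij_betw)
  then have "z ^ card (-{0::'a}) * (\<Prod>x\<in>-{0}. x) = 1 * (\<Prod>x\<in>-{0::'a}. x)"
    by (simp add: prod.distrib)
  then have "z ^ card (-{0::'a}) = 1"
    by simp
  then show ?thesis by (simp add: card_nonzero)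
qed

text \<open>
  The polynomial \<open>X\<^bsup>q-1\<^esup> - 1\<close> has \<open>q - 1\<close> roots and is \<open>X\<^sup>d - 1\<close> times a polynomial of degree
  \<open>q - 1 - d\<close>, so \<open>X\<^sup>d - 1\<close> must have \<open>d\<close> roots.
\<close>

lemma card_roots_of_unity_dvd:
  assumes "d dvd CARD('a::{field,finite}) - 1"
  shows "card {z::'a. z ^ d = 1} = d"
proof -
  define N where "N = CARD('a) - 1"
  have "N > 0"
    using card_field_gt_one[where 'a='a] by (simp add: N_def)
  obtain e where e: "N = d * e" using assms N_def by auto
  with \<open>N > 0\<close> have "d > 0" "e > 0" by auto
  define p :: "'a poly" where "p = monom 1 d - 1"
  define h :: "'a poly" where "h = (\<Sum>i<e. monom 1 (d * i))"
  have rp: "poly p z = 0 \<longleftrightarrow> z ^ d = 1" for z by (simp add: p_def poly_monom)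
  have "p \<noteq> 0" using rp[of 0] \<open>d > 0\<close> by (auto simp: power_0_left)
  have dp: "degree p \<le> d" unfolding p_def
    by (intro degree_diff_le) (simp_all add: degree_monom_le)
  have "coeff h 0 = (\<Sum>i<e. if i = 0 then 1 else 0)"
    using \<open>d > 0\<close> by (simp add: h_def coeff_sum)
  then have "h \<noteq> 0" using \<open>e > 0\<close> by auto
  have dh: "degree h \<le> N - d" unfolding h_def
  proof (intro degree_sum_le)
    fix i assume "i \<in> {..<e}"
    then have "d * i \<le> d * (e - 1)" by (intro mult_le_mono2) auto
    then show "degree (monom 1 (d * i) :: 'a poly) \<le> N - d"
      using e by (simp add: degree_monom_eq diff_mult_distrib2)
  qed simp
  have "z ^ d = 1 \<or> poly h z = 0" if "z \<noteq> 0" for z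
  proof -
    have "(z ^ d) ^ e = 1"
      using power_card_minus_one[OF that] e by (simp add: N_def flip: power_mult)
    then have "(z ^ d - 1) * (\<Sum>i<e. (z ^ d) ^ i) = 0"
      using power_diff_1_eq[of "z ^ d" e] by simp
    then show ?thesis by (auto simp: h_def poly_sum poly_monom power_mult)
  qed
  then have "- {0} \<subseteq> {z. poly p z = 0} \<union> {z. poly h z = 0}" by (auto simp: rp)
  then have "card (- {0::'a}) \<le> card {z. poly p z = 0} + card {z. poly h z = 0}"
    by (meson card_mono card_Un_le finite order_trans)
  then have "N \<le> card {z. poly p z = 0} + card {z. poly h z = 0}"
    by (simp add: N_def card_nonzero)
  moreover have "card {z. poly h z = 0} \<le> N - d" "card {z. poly p z = 0} \<le> d"
    using card_poly_roots_bound[OF \<open>h \<noteq> 0\<close>] card_poly_roots_bound[OF \<open>p \<noteq> 0\<close>] dh dp by linarith+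
  moreover have "d \<le> N" using e \<open>e > 0\<close> by simp
  ultimately show ?thesis by (simp add: rp)
qed

text \<open>Since every nonzero \<open>z\<close> has order dividing q - 1, Bezout turns
  \<open>z ^ k = 1\<close> into the same equation with exponent gcd(k, q - 1), a divisor of q -
  1.\<close>

lemma card_roots_of_unity:
  "card {z::'a::{field,finite}. z \<noteq> 0 \<and> z ^ k = 1} = gcd k (CARD('a) - 1)"
proof -
  let ?N = "CARD('a) - 1"
  have "?N > 0" using card_field_gt_one[where 'a='a] by simp
  have "z \<noteq> 0 \<and> z ^ k = 1 \<longleftrightarrow> z ^ gcd k ?N = 1" for z :: 'a
  proof
    assume z: "z \<noteq> 0 \<and> z ^ k = 1"
    \<comment> \<open>Bezout over the naturals, with the multiple of \<open>?N\<close> on the larger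
      side, so no negative exponents arise.\<close>
    obtain x y where xy: "x * ?N = y * k + gcd ?N k"
      using bezout_nat[of ?N k] \<open>?N > 0\<close> by (auto simp: mult.commute)
    have "(z ^ ?N) ^ x = z ^ (x * ?N)" by (metis mult.commute power_mult)
    also have "\<dots> = (z ^ k) ^ y * z ^ gcd ?N k"
      unfolding xy by (metis mult.commute power_add power_mult)
    finally show "z ^ gcd k ?N = 1"
      using z power_card_minus_one[of z] by (simp add: gcd.commute)
  next
    assume z: "z ^ gcd k ?N = 1"
    then have "z \<noteq> 0" using \<open>?N > 0\<close> by (auto simp: power_0_left)
    moreover obtain c where "k = gcd k ?N * c" by (meson gcd_dvd1 dvdE)
    then have "z ^ k = 1" using z by (metis power_mult power_one)
    ultimately show "z \<noteq> 0 \<and> z ^ k = 1" by simp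
  qed
  then show ?thesis using card_roots_of_unity_dvd[of "gcd k ?N", where 'a='a] by simp
qed

text \<open>Cancelling the smaller power leaves roots of unity of order dividing |m - n|; the
  integer gcd ignores the sign.\<close>

lemma card_power_eq_power:
  "int (card {z::'a::{field,finite}. z \<noteq> 0 \<and> z ^ m = z ^ n}) =
    gcd (int m - int n) (int CARD('a) - 1)"
proof (induction m n rule: linorder_wlog)
  case (le n m)
  have "z ^ n = z ^ m \<longleftrightarrow> z ^ (m - n) = 1" if "z \<noteq> 0" for z :: 'a
    using that le by (auto simp: power_diff)
  then have "{z::'a. z \<noteq> 0 \<and> z ^ n = z ^ m} = {z. z \<noteq> 0 \<and> z ^ (m - n) = 1}" by auto
  moreover have "int n - int m = - int (m - n)" "int CARD('a) - 1 = int (CARD('a) - 1)"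
    using le by (simp_all add: of_nat_diff Suc_leI)
  ultimately show ?case 
    by (simp only: card_roots_of_unity gcd_neg1_int gcd_int_int_eq)
next
  case (sym n m)
  have "gcd (int n - int m) (int CARD('a) - 1) = gcd (int m - int n) (int CARD('a) - 1)"
    by (metis gcd_neg1_int minus_diff_eq)
  then show ?case using sym by (simp add: eq_commute[of "_ ^ n"])
qed

text \<open>Substituting z = a / b reduces the equation to \<open>z ^ m = z ^ n\<close>, with
  \<open>b\<close> free among the nonzero elements.\<close>

lemma card_power_products_eq:
  "int (card {(a, b :: 'a::{field,finite}). a \<noteq> 0 \<and> b \<noteq> 0 \<and> a ^ m * b ^ n = a ^ n * b ^ m}) =
    (int CARD('a) - 1) * gcd (int m - int n) (int CARD('a) - 1)"
proof -
  have "bij_betw (\<lambda>(z, b). (z * b, b)) ({z::'a. z \<noteq> 0 \<and> z ^ m = z ^ n} \<times> (- {0}))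
     {(a, b). a \<noteq> 0 \<and> b \<noteq> 0 \<and> a ^ m * b ^ n = a ^ n * b ^ m}"
    by (rule bij_betwI[where g = "\<lambda>(a, b). (a / b, b)"])
      (auto simp: power_mult_distrib power_divide field_simps)
  from bij_betw_same_card[OF this] have
    "card {(a, b::'a). a \<noteq> 0 \<and> b \<noteq> 0 \<and> a ^ m * b ^ n = a ^ n * b ^ m} =
      card {z::'a. z \<noteq> 0 \<and> z ^ m = z ^ n} * (CARD('a) - 1)"
    by (simp add: card_cartesian_product card_nonzero)
  then show ?thesis
    by (simp add: card_power_eq_power of_nat_diff Suc_leI)
qed

lemma card_powers_eq:
  assumes "k > 0"
  shows "int (card {(a, b :: 'a::{field,finite}). a ^ k = b ^ k}) =
    1 + (int CARD('a) - 1) * gcd (int k) (int CARD('a) - 1)"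
proof -
  have "{(a, b :: 'a). a ^ k = b ^ k} =
      insert (0, 0) {(a, b). a \<noteq> 0 \<and> b \<noteq> 0 \<and> a ^ k * b ^ 0 = a ^ 0 * b ^ k}"
    using assms by (auto simp: power_0_left)
  then show ?thesis
    using card_power_products_eq[of k 0, where 'a='a] by simp
qed

text \<open>Shifting by 1 permutes the field, so summing all elements gives q * 1 = 0; if 2 = 0, odd
  q would turn this into 1 = 0.\<close>

lemma two_neq_zero_if_odd_card:
  assumes "odd CARD('a::{field,finite})"
  shows "(2::'a) \<noteq> 0"
proof
  assume two: "(2::'a) = 0"
  have "(\<Sum>x\<in>UNIV. x + 1) = (\<Sum>x\<in>UNIV. x :: 'a)"
    by (rule sum.reindex_bij_betw) (rule bij_betwI[where g = "\<lambda>x. x - 1"]; simp)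
  then have "of_nat CARD('a) = (0::'a)" by (simp add: sum.distrib)
  moreover obtain k where "CARD('a) = 2 * k + 1" using assms by (rule oddE)
  ultimately show False using two by simp
qed

section \<open>Adjacency and its counting invariants\<close>

definition adj :: "nat \<Rightarrow> nat \<Rightarrow> 'a::field \<times> 'a \<Rightarrow> 'a \<times> 'a \<Rightarrow> bool"
  where "adj m n x y \<longleftrightarrow> snd x + snd y = fst x ^ m * fst y ^ n"

lemma out_twins_iff:
  assumes "n > 0"
  shows "(\<forall>z. adj m n x z \<longleftrightarrow> adj m n y z) \<longleftrightarrow> snd x = snd y \<and> fst x ^ m = fst y ^ m"
proof
  assume twins: "\<forall>z. adj m n x z \<longleftrightarrow> adj m n y z"
  \<comment> \<open>The test vertex has first coordinate 0, which kills the product and isolates the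
    second coordinates; first coordinate 1 then isolates the \<open>m\<close>-th powers.\<close>
  have "snd x = snd y"
    using spec[OF twins, of "(0, - snd x)"] assms by (simp add: adj_def power_0_left eq_neg_iff_add_eq_0)
  then show "snd x = snd y \<and> fst x ^ m = fst y ^ m"
    using spec[OF twins, of "(1, fst x ^ m - snd x)"] by (simp add: adj_def)
qed (simp add: adj_def)

text \<open>Reversing all arcs exchanges the exponents, so facts about out-neighbours also serve for
  in-neighbours.\<close>

lemma adj_swap: "adj m n x y \<longleftrightarrow> adj n m y x"
  by (simp add: adj_def add.commute mult.commute)

lemma card_out_twins:
  assumes "m > 0" "n > 0"
  shows "int (card {(x, y :: 'a::{field,finite} \<times> 'a). \<forall>z. adj m n x z \<longleftrightarrow> adj m n y z}) =
    int CARD('a) * (1 + (int CARD('a) - 1) * gcd (int m) (int CARD('a) - 1))"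
proof -
  have "bij_betw (\<lambda>(c, a, b). ((a, c), (b, c))) (UNIV \<times> {(a, b :: 'a). a ^ m = b ^ m})
      {(x, y :: 'a \<times> 'a). \<forall>z. adj m n x z \<longleftrightarrow> adj m n y z}"
    by (rule bij_betwI[where g = "\<lambda>((a, c), (b, d)). (c, a, b)"])
      (auto simp: out_twins_iff[OF assms(2)] simp del: split_paired_All)
  from bij_betw_same_card[OF this]
  have "card {(x, y :: 'a \<times> 'a). \<forall>z. adj m n x z \<longleftrightarrow> adj m n y z} =
      CARD('a) * card {(a, b :: 'a). a ^ m = b ^ m}"
    by (simp add: card_cartesian_product)
  then show ?thesis
    using card_powers_eq[OF assms(1), where 'a='a] by (simp only: of_nat_mult)
qed

lemma card_two_way_adj:
  assumes "m > 0" "n > 0"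
  shows "int (card {(x, y :: 'a::{field,finite} \<times> 'a). adj m n x y \<and> adj m n y x}) =
    int CARD('a) * (2 * int CARD('a) - 1 +
      (int CARD('a) - 1) * gcd (int m - int n) (int CARD('a) - 1))"
proof -
  \<comment> \<open>Given first coordinates \<open>a\<close>, \<open>b\<close> satisfying the
    equation, the second coordinate of \<open>x\<close> is free and fixes that of \<open>y\<close>.
    \<open>?Z\<close> holds the 2q - 1 solutions with a zero entry.\<close>
  let ?Z = "{0} \<times> UNIV \<union> (- {0}) \<times> {0} :: ('a \<times> 'a) set"
  let ?N = "{(a, b :: 'a). a \<noteq> 0 \<and> b \<noteq> 0 \<and> a ^ m * b ^ n = a ^ n * b ^ m}"
  have "bij_betw (\<lambda>(c, a, b). ((a, c), (b, a ^ m * b ^ n - c)))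
      (UNIV \<times> {(a, b :: 'a). a ^ m * b ^ n = a ^ n * b ^ m})
      {(x, y :: 'a \<times> 'a). adj m n x y \<and> adj m n y x}"
    by (rule bij_betwI[where g = "\<lambda>((a, c), (b, d)). (c, a, b)"])
      (auto simp: adj_def algebra_simps)
  from bij_betw_same_card[OF this]
  have "card {(x, y :: 'a \<times> 'a). adj m n x y \<and> adj m n y x} =
      CARD('a) * card {(a, b :: 'a). a ^ m * b ^ n = a ^ n * b ^ m}"
    by (simp add: card_cartesian_product)
  also have "{(a, b :: 'a). a ^ m * b ^ n = a ^ n * b ^ m} = ?Z \<union> ?N"
    using assms by (auto simp: power_0_left)
  also have "card (?Z \<union> ?N) = card ?Z + card ?N"
    by (rule card_Un_disjoint) auto
  also have "card ?Z = CARD('a) + (CARD('a) - 1)"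
    by (subst card_Un_disjoint) (auto simp: card_cartesian_product card_nonzero)
  finally have "int (card {(x, y :: 'a \<times> 'a). adj m n x y \<and> adj m n y x}) =
      int CARD('a) * (2 * int CARD('a) - 1 + int (card ?N))"
    by (simp add: of_nat_diff Suc_leI)
  then show ?thesis
    by (simp only: card_power_products_eq)
qed

text \<open>All q - 1 nonzero elements solve the equation, so q - 1 divides m - n, whose absolute
  value is smaller than q - 1.\<close>

lemma eq_if_power_eq_power:
  assumes "\<And>z::'a::{field,finite}. z ^ m = z ^ n"
    and "m \<in> {1..CARD('a) - 1}" "n \<in> {1..CARD('a) - 1}"
  shows "m = n"
proof -
  have "{z::'a. z \<noteq> 0 \<and> z ^ m = z ^ n} = - {0}" using assms(1) by auto
  then have "gcd (int m - int n) (int CARD('a) - 1) = int CARD('a) - 1"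
    using card_power_eq_power[of m n, where 'a='a] by (simp add: card_nonzero of_nat_diff Suc_leI)
  then have "int CARD('a) - 1 dvd int m - int n"
    by (metis gcd_dvd1)
  moreover have "\<bar>int m - int n\<bar> < int CARD('a) - 1" using assms(2,3) by auto
  ultimately show "m = n" using dvd_imp_le_int[of "int m - int n" "int CARD('a) - 1"] by auto
qed

lemma out_nbrs_eq_in_nbrs_iff:
  fixes x :: "'a::{field,finite} \<times> 'a"
  assumes "m \<in> {1..CARD('a) - 1}" "n \<in> {1..CARD('a) - 1}" "m \<noteq> n"
  shows "(\<forall>z. adj m n x z \<longleftrightarrow> adj m n z x) \<longleftrightarrow> fst x = 0"
proof
  assume bal: "\<forall>z. adj m n x z \<longleftrightarrow> adj m n z x"
  \<comment> \<open>The test vertex is the out-neighbour of \<open>x\<close> with first coordinate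
    \<open>t\<close>; it must be an in-neighbour as well.\<close>
  have eq: "fst x ^ m * t ^ n = fst x ^ n * t ^ m" for t
    using spec[OF bal, of "(t, fst x ^ m * t ^ n - snd x)"] by (simp add: adj_def mult.commute)
  show "fst x = 0"
  proof (rule ccontr)
    assume "fst x \<noteq> 0"
    then have "t ^ m = t ^ n" for t :: 'a using eq[of 1] eq[of t] by simp
    then show False using eq_if_power_eq_power[of m n, where 'a='a] assms by blast
  qed
next
  assume "fst x = 0"
  then show "\<forall>z. adj m n x z \<longleftrightarrow> adj m n z x"
    using assms by (simp add: adj_def power_0_left add.commute)
qed

lemma card_loops_common_in_nbr:
  assumes "odd CARD('a::{field,finite})"
    and "m \<in> {1..CARD('a) - 1}" "n \<in> {1..CARD('a) - 1}" "m \<noteq> n"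
  shows "int (card {(x, y :: 'a \<times> 'a). adj m n x x \<and> adj m n y y \<and>
      (\<exists>v. (\<forall>z. adj m n v z \<longleftrightarrow> adj m n z v) \<and> adj m n v x \<and> adj m n v y)}) =
    1 + (int CARD('a) - 1) * gcd (int m + int n) (int CARD('a) - 1)"
proof -
  have two: "(2::'a) \<noteq> 0" using assms(1) by (rule two_neq_zero_if_odd_card)
  \<comment> \<open>A loop means 2 * \<open>snd x\<close> = \<open>fst x ^ (m + n)\<close>; odd q
    permits the halving.\<close>
  have loop: "adj m n x x \<longleftrightarrow> snd x = fst x ^ (m + n) / 2" for x :: "'a \<times> 'a"
    using two by (auto simp: adj_def power_add field_simps)
  have common: "(\<exists>v. (\<forall>z. adj m n v z \<longleftrightarrow> adj m n z v) \<and> adj m n v x \<and> adj m n v y) \<longleftrightarrow>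
      snd x = snd y" for x y :: "'a \<times> 'a"
  proof -
    have "adj m n (0, c) x \<longleftrightarrow> snd x = - c" for c and x :: "'a \<times> 'a"
      using assms(2) by (simp add: adj_def power_0_left eq_neg_iff_add_eq_0 add.commute)
    then show ?thesis
      unfolding out_nbrs_eq_in_nbrs_iff[OF assms(2-4)] by (auto simp: split_paired_Ex) (metis minus_minus)
  qed
  have "bij_betw (\<lambda>(a, b). ((a, a ^ (m + n) / 2), (b, b ^ (m + n) / 2)))
     {(a, b :: 'a). a ^ (m + n) = b ^ (m + n)}
     {(x, y). adj m n x x \<and> adj m n y y \<and>
      (\<exists>v. (\<forall>z. adj m n v z \<longleftrightarrow> adj m n z v) \<and> adj m n v x \<and> adj m n v y)}"
    unfolding common loop using two
    by (intro bij_betwI[where g = "\<lambda>((a, c), (b, d)). (a, b)"]) auto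
  from bij_betw_same_card[OF this] show ?thesis
    using card_powers_eq[of "m + n", where 'a='a] assms(2) by simp
qed

section \<open>Isomorphism invariance of the gcds, and independence of the conditions\<close>

text \<open>Replacing \<open>k\<close> by gcd(k, N) leaves gcd(2k, N) unchanged. This settles the
  sum condition when both exponents coincide.\<close>

lemma gcd_double_cong:
  assumes "gcd k N = gcd l (N::int)"
  shows "gcd (k + k) N = gcd (l + l) N"
proof -
  have "gcd (2 * k) N = gcd (2 * gcd k N) N" for k
  proof -
    have "gcd (2 * gcd k N) N = gcd (gcd (2 * k) (2 * N)) N"
      using gcd_mult_distrib_int[of 2 k N] by simp
    also have "\<dots> = gcd (2 * k) (gcd (2 * N) N)" by (rule gcd.assoc)
    finally show ?thesis by simp
  qed
  then show ?thesis using assms by (metis mult_2)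
qed

lemma adj_iso_gcds:
  fixes f :: "'a::{field,finite} \<times> 'a \<Rightarrow> 'a \<times> 'a"
  assumes "odd CARD('a)"
    and m1: "m1 \<in> {1..CARD('a) - 1}" and n1: "n1 \<in> {1..CARD('a) - 1}"
    and m2: "m2 \<in> {1..CARD('a) - 1}" and n2: "n2 \<in> {1..CARD('a) - 1}"
    and f: "bij f" "\<And>x y. adj m1 n1 x y \<longleftrightarrow> adj m2 n2 (f x) (f y)"
  shows "gcd_exponents_eq CARD('a) m1 n1 m2 n2 \<and> gcd_sum_eq CARD('a) m1 n1 m2 n2 \<and>
    gcd_diff_eq CARD('a) m1 n1 m2 n2"
proof -
  have q: "int CARD('a) > 1" using card_field_gt_one[where 'a='a] by simp
  have all: "(\<forall>z. P (f z)) \<longleftrightarrow> (\<forall>z. P z)" and ex: "(\<exists>z. P (f z)) \<longleftrightarrow> (\<exists>z. P z)" for P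
    using f(1) by (metis bij_pointE)+
  have "card {(x, y :: 'a \<times> 'a). \<forall>z. adj m1 n1 x z \<longleftrightarrow> adj m1 n1 y z} =
      card {(x, y :: 'a \<times> 'a). \<forall>z. adj m2 n2 x z \<longleftrightarrow> adj m2 n2 y z}"
    by (rule card_pairs_eq_if_bij[OF f(1)], unfold f(2), rule all)
  then have gm: "gcd (int m1) (int CARD('a) - 1) = gcd (int m2) (int CARD('a) - 1)"
    using card_out_twins[of m1 n1, where 'a='a] card_out_twins[of m2 n2, where 'a='a] q m1 n1 m2 n2
    by simp
  \<comment> \<open>In-twins, counted as out-twins of the reversed digraphs.\<close>
  have "card {(x, y :: 'a \<times> 'a). \<forall>z. adj n1 m1 x z \<longleftrightarrow> adj n1 m1 y z} =
      card {(x, y :: 'a \<times> 'a). \<forall>z. adj n2 m2 x z \<longleftrightarrow> adj n2 m2 y z}"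
    unfolding adj_swap[of n1] adj_swap[of n2]
    by (rule card_pairs_eq_if_bij[OF f(1)], unfold f(2), rule all)
  then have gn: "gcd (int n1) (int CARD('a) - 1) = gcd (int n2) (int CARD('a) - 1)"
    using card_out_twins[of n1 m1, where 'a='a] card_out_twins[of n2 m2, where 'a='a] q m1 n1 m2 n2
    by simp
  have "card {(x, y :: 'a \<times> 'a). adj m1 n1 x y \<and> adj m1 n1 y x} =
      card {(x, y :: 'a \<times> 'a). adj m2 n2 x y \<and> adj m2 n2 y x}"
    by (rule card_pairs_eq_if_bij[OF f(1)], unfold f(2), rule refl)
  then have gd: "gcd (int m1 - int n1) (int CARD('a) - 1) = gcd (int m2 - int n2) (int CARD('a) - 1)"
    using card_two_way_adj[of m1 n1, where 'a='a] card_two_way_adj[of m2 n2, where 'a='a] q m1 n1 m2 n2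
    by simp
  have bal: "(\<forall>z. adj m1 n1 v z \<longleftrightarrow> adj m1 n1 z v) \<longleftrightarrow>
      (\<forall>z. adj m2 n2 (f v) z \<longleftrightarrow> adj m2 n2 z (f v))" for v
    unfolding f(2) by (rule all)
  \<comment> \<open>Equal exponents mean symmetric adjacency, a property kept by isomorphism, so
    both digraphs fall into the same case below. For distinct exponents the vertex (1, 0) breaks the
    symmetry.\<close>
  have sym: "m = n \<longleftrightarrow> (\<forall>v z :: 'a \<times> 'a. adj m n v z \<longleftrightarrow> adj m n z v)"
    if "m \<in> {1..CARD('a) - 1}" "n \<in> {1..CARD('a) - 1}" for m n
    using out_nbrs_eq_in_nbrs_iff[OF that, of "(1, 0)"] adj_swap[of m m] by fastforce
  have eq_iff: "m1 = n1 \<longleftrightarrow> m2 = n2"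
    unfolding sym[OF m1 n1] sym[OF m2 n2] bal by (rule all)
  have "gcd (int m1 + int n1) (int CARD('a) - 1) = gcd (int m2 + int n2) (int CARD('a) - 1)"
  proof (cases "m1 = n1")
    case True
    with eq_iff gcd_double_cong[OF gm] show ?thesis by simp
  next
    case False
    with eq_iff have "m2 \<noteq> n2" by simp
    have "card {(x, y :: 'a \<times> 'a). adj m1 n1 x x \<and> adj m1 n1 y y \<and>
        (\<exists>v. (\<forall>z. adj m1 n1 v z \<longleftrightarrow> adj m1 n1 z v) \<and> adj m1 n1 v x \<and> adj m1 n1 v y)} =
      card {(x, y :: 'a \<times> 'a). adj m2 n2 x x \<and> adj m2 n2 y y \<and>
        (\<exists>v. (\<forall>z. adj m2 n2 v z \<longleftrightarrow> adj m2 n2 z v) \<and> adj m2 n2 v x \<and> adj m2 n2 v y)}"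
      by (rule card_pairs_eq_if_bij[OF f(1)], unfold bal, unfold f(2), subst ex, rule refl)
    then show ?thesis
      using card_loops_common_in_nbr[OF assms(1) m1 n1 False]
        card_loops_common_in_nbr[OF assms(1) m2 n2 \<open>m2 \<noteq> n2\<close>] q by simp
  qed
  with gm gn gd show ?thesis
    by (simp add: gcd_exponents_eq_def gcd_sum_eq_def gcd_diff_eq_def)
qed

theorem theorem8:
  shows
    "(\<forall>(q::nat) m1 n1 m2 n2.
        primepow q \<and> odd q \<and> CARD('a::{field,finite}) = q \<and>
        m1 \<in> {1..q - 1} \<and> n1 \<in> {1..q - 1} \<and> m2 \<in> {1..q - 1} \<and> n2 \<in> {1..q - 1} \<and>
        digraph_iso (monomial_digraph m1 n1 :: ('a \<times> 'a, _) pre_digraph)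
          (monomial_digraph m2 n2 :: ('a \<times> 'a, _) pre_digraph) \<longrightarrow>
        gcd_exponents_eq q m1 n1 m2 n2 \<and> gcd_sum_eq q m1 n1 m2 n2 \<and> gcd_diff_eq q m1 n1 m2 n2) \<and>
     (\<exists>(q::nat) m1 n1 m2 n2. primepow q \<and> odd q \<and>
        m1 \<in> {1..q - 1} \<and> n1 \<in> {1..q - 1} \<and> m2 \<in> {1..q - 1} \<and> n2 \<in> {1..q - 1} \<and>
        \<not> gcd_exponents_eq q m1 n1 m2 n2 \<and> gcd_sum_eq q m1 n1 m2 n2 \<and> gcd_diff_eq q m1 n1 m2 n2) \<and>
     (\<exists>(q::nat) m1 n1 m2 n2. primepow q \<and> odd q \<and>
        m1 \<in> {1..q - 1} \<and> n1 \<in> {1..q - 1} \<and> m2 \<in> {1..q - 1} \<and> n2 \<in> {1..q - 1} \<and>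
        gcd_exponents_eq q m1 n1 m2 n2 \<and> \<not> gcd_sum_eq q m1 n1 m2 n2 \<and> gcd_diff_eq q m1 n1 m2 n2) \<and>
     (\<exists>(q::nat) m1 n1 m2 n2. primepow q \<and> odd q \<and>
        m1 \<in> {1..q - 1} \<and> n1 \<in> {1..q - 1} \<and> m2 \<in> {1..q - 1} \<and> n2 \<in> {1..q - 1} \<and>
        gcd_exponents_eq q m1 n1 m2 n2 \<and> gcd_sum_eq q m1 n1 m2 n2 \<and> \<not> gcd_diff_eq q m1 n1 m2 n2)"
proof (intro conjI allI impI; (elim conjE)?)
  fix q m1 n1 m2 n2 :: nat
  assume asm: "odd q" "CARD('a) = q" "m1 \<in> {1..q - 1}" "n1 \<in> {1..q - 1}"
    "m2 \<in> {1..q - 1}" "n2 \<in> {1..q - 1}"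
    and "digraph_iso (monomial_digraph m1 n1 :: ('a \<times> 'a, _) pre_digraph)
      (monomial_digraph m2 n2 :: ('a \<times> 'a, _) pre_digraph)"
  then obtain f :: "'a \<times> 'a \<Rightarrow> 'a \<times> 'a" where
    "bij f" "\<And>x y. adj m1 n1 x y \<longleftrightarrow> adj m2 n2 (f x) (f y)"
    unfolding digraph_iso_monomial_digraph_iff adj_def by blast
  from adj_iso_gcds[OF _ _ _ _ _ this] asm
  show "gcd_exponents_eq q m1 n1 m2 n2" "gcd_sum_eq q m1 n1 m2 n2" "gcd_diff_eq q m1 n1 m2 n2"
    by simp_all
next
  note defs = gcd_exponents_eq_def gcd_sum_eq_def gcd_diff_eq_def
  have gcds: "gcd 3 8 = (1::int)" "gcd 7 8 = (1::int)" "gcd 6 8 = (2::int)" "gcd 5 8 = (1::int)"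
    by code_simp+
  have pp: "primepow (3::nat)" "primepow (9::nat)"
    using primepow_prime[of "3::nat"] primepow_power_iff_nat[of 3 2] by simp_all
  \<comment> \<open>Modulus 2, pairs (1, 1) and (2, 2): exponent gcds 1 and 2, while all sum and
    difference gcds are 2.\<close>
  show "\<exists>(q::nat) m1 n1 m2 n2. primepow q \<and> odd q \<and>
      m1 \<in> {1..q - 1} \<and> n1 \<in> {1..q - 1} \<and> m2 \<in> {1..q - 1} \<and> n2 \<in> {1..q - 1} \<and>
      \<not> gcd_exponents_eq q m1 n1 m2 n2 \<and> gcd_sum_eq q m1 n1 m2 n2 \<and> gcd_diff_eq q m1 n1 m2 n2"
    by (rule exI[of _ 3], rule exI[of _ 1], rule exI[of _ 1], rule exI[of _ 2], rule exI[of _ 2])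
      (simp add: defs pp)
  \<comment> \<open>Modulus 8, pairs (1, 3) and (1, 7): sum gcds 4 and 8, difference gcds both
    2.\<close>
  show "\<exists>(q::nat) m1 n1 m2 n2. primepow q \<and> odd q \<and>
      m1 \<in> {1..q - 1} \<and> n1 \<in> {1..q - 1} \<and> m2 \<in> {1..q - 1} \<and> n2 \<in> {1..q - 1} \<and>
      gcd_exponents_eq q m1 n1 m2 n2 \<and> \<not> gcd_sum_eq q m1 n1 m2 n2 \<and> gcd_diff_eq q m1 n1 m2 n2"
    by (rule exI[of _ 9], rule exI[of _ 1], rule exI[of _ 3], rule exI[of _ 1], rule exI[of _ 7])
      (simp add: defs pp gcds)
  \<comment> \<open>Modulus 8, pairs (1, 1) and (1, 5): sum gcds both 2, difference gcds 8 and
    4.\<close>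
  show "\<exists>(q::nat) m1 n1 m2 n2. primepow q \<and> odd q \<and>
      m1 \<in> {1..q - 1} \<and> n1 \<in> {1..q - 1} \<and> m2 \<in> {1..q - 1} \<and> n2 \<in> {1..q - 1} \<and>
      gcd_exponents_eq q m1 n1 m2 n2 \<and> gcd_sum_eq q m1 n1 m2 n2 \<and> \<not> gcd_diff_eq q m1 n1 m2 n2"
    by (rule exI[of _ 9], rule exI[of _ 1], rule exI[of _ 1], rule exI[of _ 1], rule exI[of _ 5])
      (simp add: defs pp gcds)
qed

end
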